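(* Let $\mathcal{E}=P+V$ be defined on the measurable subsets of $\mathbb{R}^d$, and assume that $\mathcal{E}$ satisfies the following three properties. (Energy of small balls) $\mathcal{E}(B_r)\to 0$ as $r\to 0$, and $\mathcal{E}(\emptyset)=0$. (Convergence at infinity) For any set $E\subset\mathbb{R}^d$ with $|E|<\infty$, $\mathcal{E}(E\cap B_R)\to\mathcal{E}(E)$ as $R\to\infty$. (Vanishing range of action) If $E,F\subset\mathbb{R}^d$ are bounded sets, then $\mathcal{E}(E\cup(F+Le_1))\to\mathcal{E}(E)+\mathcal{E}(F)$ as $L\to\infty$. Then for every $m>0$, $$e(m)=e_{\mathrm{gen}}(m),$$ where $$e(m)=\inf\{\mathcal{E}(E): |E|=m\},\qquad e_{\mathrm{gen}}(m)=\inf\Big\{\sum_{i\ge 1}\mathcal{E}(E^i): \sum_{i\ge 1}|E^i|=m\Big\},$$ the second infimum being over sequences $(E^i)_{i\ge 1}$ of subsets of $\mathbb{R}^d$.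
   Context: $d\ge 2$. All sets are Lebesgue measurable subsets of $\mathbb{R}^d$; $|E|$ is the Lebesgue measure of $E$; $B_r$ is the open ball of radius $r$ centered at the origin; $(e_i)_{i=1}^d$ is the canonical basis of $\mathbb{R}^d$. $P$ is a nonnegative functional on sets (a "perimeter" term, possibly $+\infty$) and $V$ is another functional on sets (a "perturbation" term, not necessarily nonnegative). *)

theory Defs
  imports "HOL-Analysis.Analysis"
begin

text \<open>
  Functionals on sets are total functions here, but they are only ever evaluated on Lebesgue
  measurable sets. \<open>P\<close> takes values in \<open>[0, \<infinity>]\<close>; the values of \<open>V\<close> are extended reals.
\<close>

definition energy ::
  "((real ^ 'd) set \<Rightarrow> ennreal) \<Rightarrow> ((real ^ 'd) set \<Rightarrow> ereal) \<Rightarrow> (real ^ 'd) set \<Rightarrow> ereal"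
  where "energy P V E = enn2ereal (P E) + V E"

definition min_energy :: "((real ^ 'd) set \<Rightarrow> ereal) \<Rightarrow> real \<Rightarrow> ereal"
  where "min_energy \<E> m =
    Inf {\<E> E | E. E \<in> sets lebesgue \<and> emeasure lebesgue E = ennreal m}"

text \<open>
  The terms of the series of energies may have either sign, so the series need not converge.
  The competitors are the sequences for which it converges, in the extended reals, in the given
  order; \<open>sums\<close> is used because \<open>suminf\<close> is unspecified on divergent series. The series of
  measures is one of nonnegative terms and always has a value in \<open>[0, \<infinity>]\<close>.
\<close>

definition gen_min_energy :: "((real ^ 'd) set \<Rightarrow> ereal) \<Rightarrow> real \<Rightarrow> ereal"
  where "gen_min_energy \<E> m =
    Inf {s. \<exists>E :: nat \<Rightarrow> (real ^ 'd) set.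
          (\<forall>i. E i \<in> sets lebesgue) \<and>
          (\<Sum>i. emeasure lebesgue (E i)) = ennreal m \<and>
          (\<lambda>i. \<E> (E i)) sums s}"

end

theory Submission
  imports Defs
begin

text \<open>
  A sequence \<open>(E\<^sup>i)\<close> with total mass \<open>m\<close> is turned into one set of mass \<open>m\<close> with almost the same
  energy. Keep finitely many of the \<open>E\<^sup>i\<close>, truncate them to a large ball, and put the mass lost
  in both operations into a single small ball. These finitely many bounded sets are then placed one
  after the other, far apart in a fixed direction. The lost mass should be small enough that every
  ball of at most that mass has small energy: nothing is assumed about how the energy of a ball
  varies with its radius away from \<open>0\<close>.
\<close>

lemma sum_ereal_not_MInf:
  fixes f :: "'i \<Rightarrow> ereal"
  assumes "\<And>i. i \<in> I \<Longrightarrow> f i \<noteq> -\<infinity>"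
  shows "sum f I \<noteq> -\<infinity>"
  using assms by (induction I rule: infinite_finite_induct) auto

text \<open>Addition of extended reals is continuous away from pairs of opposite infinities.
  Excluding -\<infinity> among the limits avoids these pairs while still allowing \<infinity>, a
  value that \<open>P\<close> may take.\<close>

lemma tendsto_sum_ereal_not_MInf:
  fixes f :: "'i \<Rightarrow> 'b \<Rightarrow> ereal"
  assumes "finite I"
    and "\<And>i. i \<in> I \<Longrightarrow> (f i \<longlongrightarrow> l i) F"
    and "\<And>i. i \<in> I \<Longrightarrow> l i \<noteq> -\<infinity>"
  shows "((\<lambda>x. \<Sum>i\<in>I. f i x) \<longlongrightarrow> (\<Sum>i\<in>I. l i)) F"
  using assms
proof (induction I)
  case (insert i I)
  have "(\<Sum>i\<in>I. l i) \<noteq> -\<infinity>"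
    using insert by (simp add: sum_ereal_not_MInf)
  then show ?case
    using insert by (auto intro!: tendsto_add_ereal_nonneg)
qed simp

lemma eventually_disjoint_translate:
  fixes E F :: "'a::real_normed_vector set"
  assumes "bounded E" "bounded F" "v \<noteq> 0"
  shows "eventually (\<lambda>L::real. E \<inter> (\<lambda>x. x + L *\<^sub>R v) ` F = {}) at_top"
proof -
  obtain a b where a: "\<And>x. x \<in> E \<Longrightarrow> norm x \<le> a" and b: "\<And>x. x \<in> F \<Longrightarrow> norm x \<le> b"
    using assms by (auto simp: bounded_iff)
  \<comment> \<open>A common point would make the shift \<open>L *\<^sub>R v\<close> a difference of
    a point of \<open>E\<close> and a point of \<open>F\<close>, hence of norm at most
    \<open>a + b\<close>.\<close>
  have disj: "E \<inter> (\<lambda>x. x + L *\<^sub>R v) ` F = {}" if L: "L > (a + b) / norm v" "L > 0" for L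
  proof (rule ccontr)
    assume "E \<inter> (\<lambda>x. x + L *\<^sub>R v) ` F \<noteq> {}"
    then obtain y where y: "y \<in> F" "y + L *\<^sub>R v \<in> E" by auto
    have "norm (L *\<^sub>R v) \<le> norm (y + L *\<^sub>R v) + norm y"
      using norm_triangle_ineq4[of "y + L *\<^sub>R v" y] by simp
    also have "\<dots> \<le> a + b" using a b y by (intro add_mono) auto
    finally have "L * norm v \<le> a + b" using L by simp
    moreover have "a + b < L * norm v" using L assms by (simp add: field_simps)
    ultimately show False by simp
  qed
  show ?thesis
    using eventually_gt_at_top[of "(a + b) / norm v"] eventually_gt_at_top[of 0]
    by eventually_elim (rule disj)
qed

lemma measure_Int_ball_tendsto:
  fixes E :: "'a::euclidean_space set"
  assumes "E \<in> lmeasurable"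
  shows "(\<lambda>n. measure lebesgue (E \<inter> ball 0 (real n))) \<longlonglongrightarrow> measure lebesgue E"
proof -
  have U: "(\<Union>n. E \<inter> ball 0 (real n)) = E"
    by (auto simp: reals_Archimedean2)
  have "range (\<lambda>n. E \<inter> ball 0 (real n)) \<subseteq> sets lebesgue"
    using assms by (auto simp: fmeasurable_def)
  moreover have "incseq (\<lambda>n. E \<inter> ball 0 (real n))"
    by (auto simp: incseq_def)
  moreover have "emeasure lebesgue (\<Union>n. E \<inter> ball 0 (real n)) \<noteq> \<infinity>"
    using assms unfolding U by (auto simp: fmeasurable_def)
  ultimately show ?thesis
    using Lim_measure_incseq[of "\<lambda>n. E \<inter> ball 0 (real n)" lebesgue] unfolding U by blast
qed

text \<open>The threshold \<eta> is the volume of a ball whose radius \<open>d\<close> is such that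
  all smaller balls have energy below \<epsilon>. Any smaller positive mass is that of a ball of
  radius less than \<open>d\<close>.\<close>

lemma small_mass_small_energy:
  fixes \<E> :: "'a::euclidean_space set \<Rightarrow> ereal"
  assumes small_balls: "((\<lambda>r. \<E> (ball 0 r)) \<longlongrightarrow> 0) (at_right (0::real))"
    and empty: "\<E> {} = 0"
    and "\<epsilon> > 0"
  obtains \<eta> where "\<eta> > 0"
    "\<And>\<mu>. 0 \<le> \<mu> \<Longrightarrow> \<mu> < \<eta> \<Longrightarrow>
      \<exists>B. B \<in> sets lebesgue \<and> bounded B \<and> measure lebesgue B = \<mu> \<and> \<E> B < \<epsilon>"
proof -
  define n where "n = DIM('a)"
  define w where "w = unit_ball_vol n"
  have n: "n > 0" by (simp add: n_def)
  have w: "w > 0" by (simp add: w_def)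
  have "eventually (\<lambda>r. \<E> (ball 0 r) < \<epsilon>) (at_right (0::real))"
    using order_tendstoD(2)[OF small_balls \<open>\<epsilon> > 0\<close>] .
  then obtain d :: real where d: "d > 0" "\<And>r. 0 < r \<Longrightarrow> r < d \<Longrightarrow> \<E> (ball 0 r) < \<epsilon>"
    by (auto simp: eventually_at_right_field)
  show thesis
  proof (rule that[of "w * d ^ n"])
    show "w * d ^ n > 0" using w d by simp
    fix \<mu> assume \<mu>: "0 \<le> \<mu>" "\<mu> < w * d ^ n"
    show "\<exists>B. B \<in> sets lebesgue \<and> bounded B \<and> measure lebesgue B = \<mu> \<and> \<E> B < \<epsilon>"
    \<comment> \<open>The one-sided limit speaks of positive radii only, so mass zero is realised by
      the empty set.\<close>
    proof (cases "\<mu> = 0")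
      case True
      then show ?thesis using empty \<open>\<epsilon> > 0\<close> by (intro exI[of _ "{}"]) auto
    next
      case False
      define r where "r = root n (\<mu> / w)"
      have r: "r > 0" using False \<mu> w n by (simp add: r_def)
      have rn: "w * r ^ n = \<mu>" using \<mu> w n by (simp add: r_def)
      then have "r ^ n < d ^ n" using \<mu> w by (metis mult_less_cancel_left_pos)
      then have "r < d" using d by (meson less_imp_le power_less_imp_less_base)
      moreover have "measure lebesgue (ball (0::'a) r) = \<mu>"
        using content_ball[of r "0::'a"] r rn by (simp add: w_def n_def)
      ultimately show ?thesis using d r by (intro exI[of _ "ball 0 r"]) auto
    qed
  qed
qed

text \<open>The induction varies \<open>G\<close>: at each step \<open>G\<close> absorbs a distant
  translate of the last \<open>F n\<close>. Keeping a strict bound \<open>c\<close> instead of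
  tracking errors works because a strict inequality for a limit holds eventually.\<close>

lemma merge_bounded_sets:
  fixes \<E> :: "'a::euclidean_space set \<Rightarrow> ereal" and F :: "nat \<Rightarrow> 'a set"
  assumes not_MInf: "\<And>E. E \<in> sets lebesgue \<Longrightarrow> bounded E \<Longrightarrow> \<E> E \<noteq> -\<infinity>"
    and "v \<noteq> 0"
    and vanishing_range:
      "\<And>E F. E \<in> sets lebesgue \<Longrightarrow> bounded E \<Longrightarrow> F \<in> sets lebesgue \<Longrightarrow> bounded F \<Longrightarrow>
         ((\<lambda>L::real. \<E> (E \<union> (\<lambda>x. x + L *\<^sub>R v) ` F)) \<longlongrightarrow> \<E> E + \<E> F) at_top"
    and F: "\<And>i. i < n \<Longrightarrow> F i \<in> sets lebesgue" "\<And>i. i < n \<Longrightarrow> bounded (F i)"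
    and G: "G \<in> sets lebesgue" "bounded G"
    and less: "\<E> G + (\<Sum>i<n. \<E> (F i)) < c"
  obtains H where "H \<in> sets lebesgue" "bounded H" "\<E> H < c"
    "measure lebesgue H = measure lebesgue G + (\<Sum>i<n. measure lebesgue (F i))"
  using F G less
proof (induction n arbitrary: G thesis)
  case 0
  show ?case by (rule 0(1)[of G]) (use 0 in simp_all)
next
  case (Suc n)
  let ?S = "\<Sum>i<n. \<E> (F i)"
  let ?T = "\<lambda>L. (\<lambda>x. x + L *\<^sub>R v) ` F n"
  have S: "?S \<noteq> -\<infinity>" using Suc.prems by (intro sum_ereal_not_MInf not_MInf) auto
  have "\<E> G \<noteq> -\<infinity>" "\<E> (F n) \<noteq> -\<infinity>" using Suc.prems not_MInf by auto
  \<comment> \<open>The energies still to be merged are carried along as the constant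
    \<open>?S\<close>, so that the bound obtained is exactly the premise of the induction hypothesis
    for \<open>G \<union> ?T L\<close>.\<close>
  then have "((\<lambda>L. \<E> (G \<union> ?T L) + ?S) \<longlongrightarrow> (\<E> G + \<E> (F n)) + ?S) at_top"
    using S Suc.prems by (intro tendsto_add_ereal_nonneg vanishing_range) auto
  moreover have "(\<E> G + \<E> (F n)) + ?S < c"
    using Suc.prems by (simp add: ac_simps)
  ultimately have "eventually (\<lambda>L. \<E> (G \<union> ?T L) + ?S < c) at_top"
    by (rule order_tendstoD)
  moreover have "eventually (\<lambda>L. G \<inter> ?T L = {}) at_top"
    using Suc.prems \<open>v \<noteq> 0\<close> by (intro eventually_disjoint_translate) auto
  ultimately have "eventually (\<lambda>L. \<E> (G \<union> ?T L) + ?S < c \<and> G \<inter> ?T L = {}) at_top"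
    by (rule eventually_conj)
  then obtain L where L: "\<E> (G \<union> ?T L) + ?S < c" "G \<inter> ?T L = {}"
    using eventually_happens'[OF trivial_limit_at_top_linorder] by blast
  have T_eq: "?T L = (+) (L *\<^sub>R v) ` F n" by (auto simp: add.commute)
  have T: "?T L \<in> sets lebesgue" "bounded (?T L)"
    unfolding T_eq using Suc.prems by (auto intro: lebesgue_sets_translation bounded_translation)
  have "measure lebesgue (G \<union> ?T L) = measure lebesgue G + measure lebesgue (?T L)"
    using T L Suc.prems by (intro measure_Un3 [THEN trans] bounded_set_imp_lmeasurable) auto
  also have "measure lebesgue (?T L) = measure lebesgue (F n)"
    unfolding T_eq by (rule measure_translation)
  finally have meas: "measure lebesgue (G \<union> ?T L) = measure lebesgue G + measure lebesgue (F n)" .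
  show ?case
  proof (rule Suc.IH[of "G \<union> ?T L"])
    fix H
    assume "H \<in> sets lebesgue" "bounded H" "\<E> H < c"
      "measure lebesgue H = measure lebesgue (G \<union> ?T L) + (\<Sum>i<n. measure lebesgue (F i))"
    then show ?thesis using Suc.prems(1)[of H] by (simp add: meas)
  qed (use Suc.prems T L in auto)
qed

text \<open>An arbitrary bound \<open>c\<close> above \<open>s\<close> replaces \<open>s\<close>
  plus a small error, which also covers \<open>s\<close> equal to -\<infinity>.\<close>

lemma competitor_from_sequence:
  fixes \<E> :: "'a::euclidean_space set \<Rightarrow> ereal"
  assumes not_MInf: "\<And>E. E \<in> lmeasurable \<Longrightarrow> \<E> E \<noteq> -\<infinity>"
    and small_balls: "((\<lambda>r. \<E> (ball 0 r)) \<longlongrightarrow> 0) (at_right (0::real))"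
    and empty: "\<E> {} = 0"
    and conv_at_infinity:
      "\<And>E. E \<in> lmeasurable \<Longrightarrow> ((\<lambda>R::real. \<E> (E \<inter> ball 0 R)) \<longlongrightarrow> \<E> E) at_top"
    and "v \<noteq> 0"
    and vanishing_range:
      "\<And>E F. E \<in> sets lebesgue \<Longrightarrow> bounded E \<Longrightarrow> F \<in> sets lebesgue \<Longrightarrow> bounded F \<Longrightarrow>
         ((\<lambda>L::real. \<E> (E \<union> (\<lambda>x. x + L *\<^sub>R v) ` F)) \<longlongrightarrow> \<E> E + \<E> F) at_top"
    and E: "\<And>i. E i \<in> lmeasurable"
    and mass: "(\<lambda>i. measure lebesgue (E i)) sums m"
    and energy: "(\<lambda>i. \<E> (E i)) sums s"
    and "s < c"
  obtains H where "H \<in> lmeasurable" "measure lebesgue H = m" "\<E> H < c"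
proof -
  \<comment> \<open>The margin is split with two reals: the truncated pieces get total energy below
    \<open>c1\<close>, and the gap \<open>c2 - c1\<close> is left for the ball.\<close>
  obtain c1 where c1: "s < ereal c1" "ereal c1 < c" using ereal_dense2 \<open>s < c\<close> by blast
  obtain c2 where c2: "ereal c1 < ereal c2" "ereal c2 < c" using ereal_dense2 c1 by blast
  \<comment> \<open>The threshold depends only on \<open>c2 - c1\<close>, so the cutoffs
    \<open>n\<close> and \<open>R\<close> can be chosen afterwards to make the lost mass smaller
    than it.\<close>
  obtain \<eta> where \<eta>: "\<eta> > 0"
    "\<And>\<mu>. 0 \<le> \<mu> \<Longrightarrow> \<mu> < \<eta> \<Longrightarrow>
      \<exists>B. B \<in> sets lebesgue \<and> bounded B \<and> measure lebesgue B = \<mu> \<and> \<E> B < ereal (c2 - c1)"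
    using small_mass_small_energy[OF small_balls empty, of "ereal (c2 - c1)"] c2 by auto
  have "eventually (\<lambda>n. (\<Sum>i<n. \<E> (E i)) < ereal c1) sequentially"
    using energy c1 unfolding sums_def by (intro order_tendstoD(2))
  moreover have "eventually (\<lambda>n. m - \<eta> < (\<Sum>i<n. measure lebesgue (E i))) sequentially"
    using mass \<eta> unfolding sums_def by (intro order_tendstoD(1)) auto
  ultimately have "eventually (\<lambda>n. (\<Sum>i<n. \<E> (E i)) < ereal c1
      \<and> m - \<eta> < (\<Sum>i<n. measure lebesgue (E i))) sequentially"
    by (rule eventually_conj)
  then obtain n where n: "(\<Sum>i<n. \<E> (E i)) < ereal c1"
      "m - \<eta> < (\<Sum>i<n. measure lebesgue (E i))"
    using eventually_happens'[OF sequentially_bot] by blast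
  let ?F = "\<lambda>R i. E i \<inter> ball 0 (real R)"
  have "(\<lambda>R. \<E> (?F R i)) \<longlonglongrightarrow> \<E> (E i)" for i
    using filterlim_compose[OF conv_at_infinity[OF E] filterlim_real_sequentially] .
  then have "(\<lambda>R. \<Sum>i<n. \<E> (?F R i)) \<longlonglongrightarrow> (\<Sum>i<n. \<E> (E i))"
    using E not_MInf by (intro tendsto_sum_ereal_not_MInf) auto
  then have "eventually (\<lambda>R. (\<Sum>i<n. \<E> (?F R i)) < ereal c1) sequentially"
    using n(1) by (rule order_tendstoD)
  moreover have "(\<lambda>R. \<Sum>i<n. measure lebesgue (?F R i)) \<longlonglongrightarrow> (\<Sum>i<n. measure lebesgue (E i))"
    by (intro tendsto_sum measure_Int_ball_tendsto E)
  then have "eventually (\<lambda>R. m - \<eta> < (\<Sum>i<n. measure lebesgue (?F R i))) sequentially"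
    using n(2) by (rule order_tendstoD)
  ultimately have "eventually (\<lambda>R. (\<Sum>i<n. \<E> (?F R i)) < ereal c1
      \<and> m - \<eta> < (\<Sum>i<n. measure lebesgue (?F R i))) sequentially"
    by (rule eventually_conj)
  then obtain R where R: "(\<Sum>i<n. \<E> (?F R i)) < ereal c1"
      "m - \<eta> < (\<Sum>i<n. measure lebesgue (?F R i))"
    using eventually_happens'[OF sequentially_bot] by blast
  \<comment> \<open>All the missing mass at once: the discarded tail of the sequence and the parts
    cut off outside the ball of radius \<open>R\<close>. It lies between 0 and \<eta>.\<close>
  define \<mu> where "\<mu> = m - (\<Sum>i<n. measure lebesgue (?F R i))"
  have "(\<Sum>i<n. measure lebesgue (?F R i)) \<le> (\<Sum>i<n. measure lebesgue (E i))"
    using E by (intro sum_mono measure_mono_fmeasurable) (auto simp: fmeasurableD)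
  also have "\<dots> \<le> m"
    using sum_le_suminf[of "\<lambda>i. measure lebesgue (E i)" "{..<n}"] mass by (auto simp: sums_iff)
  finally obtain B where B: "B \<in> sets lebesgue" "bounded B" "measure lebesgue B = \<mu>"
      "\<E> B < ereal (c2 - c1)"
    using \<eta>(2)[of \<mu>] R by (auto simp: \<mu>_def)
  have "\<E> B + (\<Sum>i<n. \<E> (?F R i)) < ereal (c2 - c1) + ereal c1"
    using B R by (intro ereal_add_strict_mono2)
  also have "\<dots> < c" using c2 by simp
  finally have less: "\<E> B + (\<Sum>i<n. \<E> (?F R i)) < c" .
  obtain H where H: "H \<in> sets lebesgue" "bounded H" "\<E> H < c"
      "measure lebesgue H = measure lebesgue B + (\<Sum>i<n. measure lebesgue (?F R i))"
  \<comment> \<open>The compensating ball \<open>B\<close> is the starting set, to which the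
    truncated pieces are attached. The masses then add up to \<open>m\<close> by the choice of
    \<mu>.\<close>
  proof (rule merge_bounded_sets[of \<E> v n "?F R" B c, OF _ \<open>v \<noteq> 0\<close> vanishing_range])
    show "\<E> A \<noteq> -\<infinity>" if "A \<in> sets lebesgue" "bounded A" for A
      using that by (intro not_MInf bounded_set_imp_lmeasurable)
  qed (use E B less in \<open>auto simp: fmeasurableD\<close>)
  then show thesis
    using that[of H] B by (simp add: bounded_set_imp_lmeasurable \<mu>_def)
qed

theorem proposition1p1:
  fixes P :: "(real ^ 'd) set \<Rightarrow> ennreal"
    and V :: "(real ^ 'd) set \<Rightarrow> ereal"
    and k :: 'd  \<comment> \<open>the index of the basis vector \<open>e\<^sub>1\<close>\<close>
    and m :: real
  assumes dim: "CARD('d) \<ge> 2"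
    and V_not_MInf:
      "\<And>E. E \<in> sets lebesgue \<Longrightarrow> emeasure lebesgue E < \<infinity> \<Longrightarrow> V E \<noteq> - \<infinity>"
    and small_balls: "((\<lambda>r. energy P V (ball 0 r)) \<longlongrightarrow> 0) (at_right (0::real))"
    and empty: "energy P V {} = 0"
    and conv_at_infinity:
      "\<And>E. E \<in> sets lebesgue \<Longrightarrow> emeasure lebesgue E < \<infinity> \<Longrightarrow>
         ((\<lambda>R::real. energy P V (E \<inter> ball 0 R)) \<longlongrightarrow> energy P V E) at_top"
    and vanishing_range:
      "\<And>E F. E \<in> sets lebesgue \<Longrightarrow> bounded E \<Longrightarrow> F \<in> sets lebesgue \<Longrightarrow> bounded F \<Longrightarrow>
         ((\<lambda>L::real. energy P V (E \<union> (\<lambda>x. x + L *\<^sub>R axis k 1) ` F))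
            \<longlongrightarrow> energy P V E + energy P V F) at_top"
    and "m > 0"
  shows "min_energy (energy P V) m = gen_min_energy (energy P V) m"
proof (rule antisym)
  let ?\<E> = "energy P V"
  show "gen_min_energy ?\<E> m \<le> min_energy ?\<E> m"
    unfolding min_energy_def
  proof (rule Inf_greatest, clarify)
    fix E :: "(real ^ 'd) set"
    assume E: "E \<in> sets lebesgue" "emeasure lebesgue E = ennreal m"
    \<comment> \<open>A single set is a generalized competitor once padded with empty sets, which
      carry neither mass nor energy.\<close>
    define F where "F = (\<lambda>i::nat. if i = 0 then E else {})"
    have "(\<lambda>i. emeasure lebesgue (F i)) sums (\<Sum>i\<in>{0}. emeasure lebesgue (F i))"
      by (intro sums_finite) (auto simp: F_def)
    then have "(\<Sum>i. emeasure lebesgue (F i)) = ennreal m"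
      using E by (simp add: F_def sums_iff)
    moreover have "(\<lambda>i. ?\<E> (F i)) sums (\<Sum>i\<in>{0}. ?\<E> (F i))"
      by (intro sums_finite) (auto simp: F_def empty)
    then have "(\<lambda>i. ?\<E> (F i)) sums ?\<E> E" by (simp add: F_def)
    moreover have "\<forall>i. F i \<in> sets lebesgue" using E by (simp add: F_def)
    ultimately show "gen_min_energy ?\<E> m \<le> ?\<E> E"
      unfolding gen_min_energy_def by (intro Inf_lower) blast
  qed
  show "min_energy ?\<E> m \<le> gen_min_energy ?\<E> m"
    unfolding gen_min_energy_def
  proof (rule Inf_greatest, clarify)
    fix s and E :: "nat \<Rightarrow> (real ^ 'd) set"
    assume E: "\<forall>i. E i \<in> sets lebesgue"
      and mass: "(\<Sum>i. emeasure lebesgue (E i)) = ennreal m"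
      and energy: "(\<lambda>i. ?\<E> (E i)) sums s"
    \<comment> \<open>Finite total mass makes each term finite, so the mass series can be read in
      the reals.\<close>
    have fin: "emeasure lebesgue (E i) < \<infinity>" for i
      by (rule ennreal_suminf_lessD) (simp add: mass)
    then have lm: "E i \<in> lmeasurable" for i
      using E by (simp add: fmeasurable_def)
    have "(\<lambda>i. emeasure lebesgue (E i)) sums ennreal m"
      using mass summableI summable_sums by metis
    then have "(\<lambda>i. ennreal (measure lebesgue (E i))) sums ennreal m"
      using lm by (simp add: emeasure_eq_measure2)
    then have sums: "(\<lambda>i. measure lebesgue (E i)) sums m"
      using \<open>m > 0\<close> by simp
    show "min_energy ?\<E> m \<le> s"
    \<comment> \<open>Neither infimum need be attained, so \<open>s\<close> is approached through
      all \<open>c\<close> above it.\<close>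
    proof (rule dense_ge)
      fix c assume "s < c"
      \<comment> \<open>Since \<open>P\<close> is nonnegative, only \<open>V\<close> could produce
        the value -\<infinity>.\<close>
      have not_MInf: "?\<E> A \<noteq> -\<infinity>" if "A \<in> lmeasurable" for A
        using V_not_MInf[OF fmeasurableD[OF that]] fmeasurableD2[OF that]
        by (simp add: energy_def less_top del: emeasure_completion)
      have conv: "((\<lambda>R::real. ?\<E> (A \<inter> ball 0 R)) \<longlongrightarrow> ?\<E> A) at_top" if "A \<in> lmeasurable" for A
        using conv_at_infinity[OF fmeasurableD[OF that]] fmeasurableD2[OF that]
        by (simp add: less_top del: emeasure_completion)
      have "axis k (1::real) \<noteq> 0" by (simp add: axis_eq_0_iff)
      from competitor_from_sequence[OF not_MInf small_balls empty conv this
          vanishing_range lm sums energy \<open>s < c\<close>]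
      obtain H where "H \<in> lmeasurable" "measure lebesgue H = m" "?\<E> H < c" .
      then show "min_energy ?\<E> m \<le> c"
        unfolding min_energy_def
        by (intro Inf_lower2[of "?\<E> H"]) (auto simp: emeasure_eq_measure2 fmeasurableD)
    qed
  qed
qed

end
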